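(* (Fundamental Theorem of Finite Diamond-colored Distributive Lattices) (1) Let $L$ be a diamond-colored distributive lattice. Then, as edge-colored posets, $$L\cong\mathbf J_{color}(\mathbf j_{color}(L))\cong\mathbf M_{color}(\mathbf m_{color}(L)).$$ (2) Let $P$ be a vertex-colored poset. Then, as vertex-colored posets, $$P\cong\mathbf j_{color}(\mathbf J_{color}(P))\cong\mathbf m_{color}(\mathbf M_{color}(P)).$$
   Context: All posets and lattices are finite. The order diagram of a poset has a directed edge $\mathbf x\to\mathbf y$ iff $\mathbf y$ covers $\mathbf x$. A poset is vertex-colored (edge-colored) by a set $I$ if each element (each edge of the order diagram) is assigned a color in $I$. Isomorphisms of vertex-colored (edge-colored) posets are poset isomorphisms preserving vertex (edge) colors. An edge-colored poset is diamond-colored if, whenever $\mathbf v\to\mathbf s$, $\mathbf v\to\mathbf t$, $\mathbf s\to\mathbf u$, $\mathbf t\to\mathbf u$ with $\mathbf s\ne\mathbf t$, the edges $\mathbf v\to\mathbf s$ and $\mathbf t\to\mathbf u$ have the same color and the edges $\mathbf v\to\mathbf t$ and $\mathbf s\to\mathbf u$ have the same color. For a vertex-colored poset $P$: $\mathbf J_{color}(P)$ is the set of order ideals (down-closed subsets) of $P$ ordered by inclusion, where an edge $\mathbf x\to\mathbf y$ (so $\mathbf y-\mathbf x=\{v\}$) gets the color of $v$. $\mathbf M_{color}(P)$ is the set of filters (up-closed subsets) of $P$ ordered by reverse inclusion, where an edge $\mathbf x\to\mathbf y$ (so $\mathbf x-\mathbf y=\{v\}$) gets the color of $v$. Both are diamond-colored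 distributive lattices. For a diamond-colored distributive lattice $L$: $\mathbf j_{color}(L)$ is the set of join irreducible elements (those covering exactly one element) with the induced order, a join irreducible $\mathbf x$ covering $\mathbf x'$ being colored by the color of $\mathbf x'\to\mathbf x$. $\mathbf m_{color}(L)$ is the set of meet irreducible elements (those covered by exactly one element) with the induced order, a meet irreducible $\mathbf x$ covered by $\mathbf x'$ being colored by the color of $\mathbf x\to\mathbf x'$. *)

theory Defs
  imports "HOL-Algebra.Lattice"
begin

text \<open>
  The value of \<open>vcolor\<close> is relevant only on the carrier, that of \<open>ecolor x y\<close> only if
  \<open>y\<close> covers \<open>x\<close>. The set of colors is the type \<open>'c\<close>.
\<close>

record ('a, 'c) vposet = "'a gorder" +
  vcolor :: "'a \<Rightarrow> 'c"

record ('a, 'c) eposet = "'a gorder" +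
  ecolor :: "'a \<Rightarrow> 'a \<Rightarrow> 'c"

definition covered_by :: "('a, 'm) gorder_scheme \<Rightarrow> 'a \<Rightarrow> 'a \<Rightarrow> bool"
    (infixl \<open>\<prec>\<index>\<close> 50) where
  "x \<prec>\<^bsub>L\<^esub> y \<longleftrightarrow> x \<in> carrier L \<and> y \<in> carrier L \<and> x \<sqsubset>\<^bsub>L\<^esub> y
     \<and> \<not> (\<exists>z \<in> carrier L. x \<sqsubset>\<^bsub>L\<^esub> z \<and> z \<sqsubset>\<^bsub>L\<^esub> y)"

definition poset_iso ::
    "('a \<Rightarrow> 'b) \<Rightarrow> ('a, 'm) gorder_scheme \<Rightarrow> ('b, 'n) gorder_scheme \<Rightarrow> bool" where
  "poset_iso f P Q \<longleftrightarrow> bij_betw f (carrier P) (carrier Q)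
     \<and> (\<forall>x \<in> carrier P. \<forall>y \<in> carrier P. x \<sqsubseteq>\<^bsub>P\<^esub> y \<longleftrightarrow> f x \<sqsubseteq>\<^bsub>Q\<^esub> f y)"

definition viso :: "('a, 'c) vposet \<Rightarrow> ('b, 'c) vposet \<Rightarrow> bool" (infix \<open>\<cong>\<^sub>V\<close> 50) where
  "P \<cong>\<^sub>V Q \<longleftrightarrow> (\<exists>f. poset_iso f P Q
     \<and> (\<forall>x \<in> carrier P. vcolor Q (f x) = vcolor P x))"

definition eiso :: "('a, 'c) eposet \<Rightarrow> ('b, 'c) eposet \<Rightarrow> bool" (infix \<open>\<cong>\<^sub>E\<close> 50) where
  "P \<cong>\<^sub>E Q \<longleftrightarrow> (\<exists>f. poset_iso f P Q
     \<and> (\<forall>x y. x \<prec>\<^bsub>P\<^esub> y \<longrightarrow> ecolor Q (f x) (f y) = ecolor P x y))"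

locale vertex_colored_poset = partial_order P
  for P :: "('a, 'c) vposet" (structure) +
  assumes finite_carrier: "finite (carrier P)"

text \<open>
  The locale \<^locale>\<open>lattice\<close> admits the empty carrier. Lattices are nonempty here: the ideals of
  the empty poset form a lattice with one element.
\<close>

locale diamond_colored_distributive_lattice = lattice L
  for L :: "('a, 'c) eposet" (structure) +
  assumes finite_carrier: "finite (carrier L)"
    and nonempty: "carrier L \<noteq> {}"
    and distrib: "\<lbrakk>x \<in> carrier L; y \<in> carrier L; z \<in> carrier L\<rbrakk>
      \<Longrightarrow> x \<sqinter> (y \<squnion> z) = (x \<sqinter> y) \<squnion> (x \<sqinter> z)"
    and diamond: "\<lbrakk>v \<prec> s; v \<prec> t; s \<prec> u; t \<prec> u; s \<noteq> t\<rbrakk>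
      \<Longrightarrow> ecolor L v s = ecolor L t u \<and> ecolor L v t = ecolor L s u"

definition order_ideals :: "('a, 'm) gorder_scheme \<Rightarrow> 'a set set" where
  "order_ideals P = {A. A \<subseteq> carrier P
     \<and> (\<forall>x \<in> A. \<forall>y \<in> carrier P. y \<sqsubseteq>\<^bsub>P\<^esub> x \<longrightarrow> y \<in> A)}"

definition order_filters :: "('a, 'm) gorder_scheme \<Rightarrow> 'a set set" where
  "order_filters P = {A. A \<subseteq> carrier P
     \<and> (\<forall>x \<in> A. \<forall>y \<in> carrier P. x \<sqsubseteq>\<^bsub>P\<^esub> y \<longrightarrow> y \<in> A)}"

definition J_color :: "('a, 'c) vposet \<Rightarrow> ('a set, 'c) eposet" where
  "J_color P = \<lparr>carrier = order_ideals P, eq = (=), le = (\<lambda>A B. A \<subseteq> B),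
     ecolor = (\<lambda>A B. vcolor P (the_elem (B - A)))\<rparr>"

definition M_color :: "('a, 'c) vposet \<Rightarrow> ('a set, 'c) eposet" where
  "M_color P = \<lparr>carrier = order_filters P, eq = (=), le = (\<lambda>A B. B \<subseteq> A),
     ecolor = (\<lambda>A B. vcolor P (the_elem (A - B)))\<rparr>"

definition join_irreducibles :: "('a, 'm) gorder_scheme \<Rightarrow> 'a set" where
  "join_irreducibles L = {x \<in> carrier L. \<exists>!x'. x' \<prec>\<^bsub>L\<^esub> x}"

definition meet_irreducibles :: "('a, 'm) gorder_scheme \<Rightarrow> 'a set" where
  "meet_irreducibles L = {x \<in> carrier L. \<exists>!x'. x \<prec>\<^bsub>L\<^esub> x'}"

definition j_color :: "('a, 'c) eposet \<Rightarrow> ('a, 'c) vposet" where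
  "j_color L = \<lparr>carrier = join_irreducibles L, eq = (.=\<^bsub>L\<^esub>), le = (\<sqsubseteq>\<^bsub>L\<^esub>),
     vcolor = (\<lambda>x. ecolor L (THE x'. x' \<prec>\<^bsub>L\<^esub> x) x)\<rparr>"

definition m_color :: "('a, 'c) eposet \<Rightarrow> ('a, 'c) vposet" where
  "m_color L = \<lparr>carrier = meet_irreducibles L, eq = (.=\<^bsub>L\<^esub>), le = (\<sqsubseteq>\<^bsub>L\<^esub>),
     vcolor = (\<lambda>x. ecolor L x (THE x'. x \<prec>\<^bsub>L\<^esub> x'))\<rparr>"

end

theory Submission
  imports Defs
begin

text \<open>
  The claims about \<^const>\<open>M_color\<close> and \<^const>\<open>m_color\<close> are the order duals of those about
  \<^const>\<open>J_color\<close> and \<^const>\<open>j_color\<close>: reversing the order, and with it the arguments of the edge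
  coloring, exchanges meet with join irreducibles and filters with ideals, colors included, and the
  dual of a diamond-colored distributive lattice is again one. So only
  \<open>L \<cong>\<^sub>E J_color (j_color L)\<close> and \<open>P \<cong>\<^sub>V j_color (J_color P)\<close> need a proof.

  For a lattice, the isomorphism is Birkhoff's: \<open>x\<close> goes to the set of join irreducibles below \<open>x\<close>.
  It reflects the order since by finiteness an element not below \<open>y\<close> has a join irreducible below it
  that is not below \<open>y\<close> (\<open>join_irreducible_separates\<close>), and it is onto since in a distributive
  lattice a join irreducible is join prime (\<open>join_irreducible_join_prime\<close>), so that joins go to
  unions. The remaining point is that it respects colors. If \<open>y\<close> covers \<open>x\<close>,
  exactly one join irreducible \<open>v\<close> is below \<open>y\<close> but not below \<open>x\<close>, and the edge into \<open>v\<close> has to have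
  the color of \<open>x \<rightarrow> y\<close>. If \<open>y\<close> is itself join irreducible, then \<open>v = y\<close> and the two edges are the
  same. Otherwise \<open>y\<close> covers some \<open>c \<noteq> x\<close>, and by modularity \<open>x \<sqinter> c\<close>, \<open>x\<close>, \<open>c\<close>, \<open>y\<close>
  form a diamond, whose opposite edges \<open>x \<rightarrow> y\<close> and \<open>x \<sqinter> c \<rightarrow> c\<close> have the same color; this
  moves the edge strictly down, to the same \<open>v\<close>, and the process ends at the edge into \<open>v\<close>
  (\<open>edge_color_from_join_irreducible\<close>).

  For a poset, the ideals covered by an ideal \<open>A\<close> are the sets \<open>A - {m}\<close> with \<open>m\<close> maximal in \<open>A\<close>, so
  the join irreducible ideals are those with a single maximal element, the principal ones (\<open>join_irreducibles_J_color\<close>). The edge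
  into the principal ideal of \<open>p\<close> adds the element \<open>p\<close> and hence has its color.
\<close>

section \<open>Finite posets\<close>

locale finite_partial_order = partial_order +
  assumes finite_elements: "finite (carrier L)"
begin

lemma exists_minimal:
  assumes "A \<subseteq> carrier L" "A \<noteq> {}"
  shows "\<exists>m \<in> A. \<forall>x \<in> A. x \<sqsubseteq> m \<longrightarrow> x = m"
proof -
  have "asymp_on A (\<lambda>x y. x \<sqsubset> y)" "transp_on A (\<lambda>x y. x \<sqsubset> y)"
    using assms(1) by (auto simp: asymp_on_def transp_on_def subset_iff intro: lless_antisym lless_trans)
  from Finite_Set.bex_min_element[OF finite_subset[OF assms(1) finite_elements] this assms(2)]
  show ?thesis by (auto simp: lless_eq)
qed

lemma exists_maximal:
  assumes "A \<subseteq> carrier L" "A \<noteq> {}"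
  shows "\<exists>m \<in> A. \<forall>x \<in> A. m \<sqsubseteq> x \<longrightarrow> x = m"
proof -
  have "asymp_on A (\<lambda>x y. x \<sqsubset> y)" "transp_on A (\<lambda>x y. x \<sqsubset> y)"
    using assms(1) by (auto simp: asymp_on_def transp_on_def subset_iff intro: lless_antisym lless_trans)
  from Finite_Set.bex_max_element[OF finite_subset[OF assms(1) finite_elements] this assms(2)]
  show ?thesis by (auto simp: lless_eq)
qed

lemma lower_cover_exists:
  assumes "w \<in> carrier L" "z \<in> carrier L" "w \<sqsubset> z"
  shows "\<exists>c. w \<sqsubseteq> c \<and> c \<prec> z"
proof -
  let ?A = "{c \<in> carrier L. w \<sqsubseteq> c \<and> c \<sqsubset> z}"
  have "w \<in> ?A" using assms by simp
  then obtain c where c: "c \<in> ?A" and max: "\<forall>x \<in> ?A. c \<sqsubseteq> x \<longrightarrow> x = c"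
    using exists_maximal[of ?A] by blast
  have "\<not> (\<exists>u \<in> carrier L. c \<sqsubset> u \<and> u \<sqsubset> z)"
  proof
    assume "\<exists>u \<in> carrier L. c \<sqsubset> u \<and> u \<sqsubset> z"
    then obtain u where u: "u \<in> carrier L" "c \<sqsubset> u" "u \<sqsubset> z" by blast
    have "u \<in> ?A" using u c assms le_trans[of w c u] by (simp add: lless_eq)
    with max u(2) show False by (auto simp: lless_eq)
  qed
  with c assms show ?thesis by (auto simp: covered_by_def)
qed

end

lemma covered_by_carrier:
  assumes "x \<prec>\<^bsub>L\<^esub> y"
  shows "x \<in> carrier L" "y \<in> carrier L"
  using assms by (auto simp: covered_by_def)

context partial_order
begin

lemma covered_by_le: "x \<prec> y \<Longrightarrow> x \<sqsubseteq> y"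
  by (simp add: covered_by_def lless_eq)

lemma covered_by_neq: "x \<prec> y \<Longrightarrow> x \<noteq> y"
  by (simp add: covered_by_def lless_eq)

lemma covered_by_not_le: "x \<prec> y \<Longrightarrow> \<not> y \<sqsubseteq> x"
  using covered_by_carrier covered_by_le covered_by_neq le_antisym by metis

lemma covered_by_between:
  assumes "x \<prec> y" "z \<in> carrier L" "x \<sqsubseteq> z" "z \<sqsubseteq> y"
  shows "z = x \<or> z = y"
  using assms by (auto simp: covered_by_def lless_eq)

end

sublocale vertex_colored_poset \<subseteq> finite_partial_order P
  by unfold_locales (rule finite_carrier)

sublocale diamond_colored_distributive_lattice \<subseteq> finite_partial_order L
  by unfold_locales (rule finite_carrier)

section \<open>Isomorphisms\<close>

lemma poset_iso_inv:
  assumes "poset_iso f P Q"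
  shows "poset_iso (inv_into (carrier P) f) Q P"
  unfolding poset_iso_def
proof (intro conjI ballI)
  let ?g = "inv_into (carrier P) f"
  have bij: "bij_betw f (carrier P) (carrier Q)"
    using assms by (simp add: poset_iso_def)
  show g: "bij_betw ?g (carrier Q) (carrier P)"
    by (rule bij_betw_inv_into[OF bij])
  fix x y assume x: "x \<in> carrier Q" and y: "y \<in> carrier Q"
  have "?g x \<in> carrier P" "?g y \<in> carrier P"
    using g x y by (auto dest: bij_betwE)
  with assms show "x \<sqsubseteq>\<^bsub>Q\<^esub> y \<longleftrightarrow> ?g x \<sqsubseteq>\<^bsub>P\<^esub> ?g y"
    by (simp add: poset_iso_def bij_betw_inv_into_right[OF bij x] bij_betw_inv_into_right[OF bij y])
qed

lemma poset_iso_comp: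
  assumes "poset_iso f P Q" "poset_iso g Q R"
  shows "poset_iso (g \<circ> f) P R"
  using assms bij_betw_trans[of f "carrier P" "carrier Q" g "carrier R"]
  by (auto simp: poset_iso_def bij_betwE)

lemma poset_iso_covered_by:
  assumes iso: "poset_iso f P Q" and P: "eq P = (=)" and Q: "eq Q = (=)"
    and xy: "x \<prec>\<^bsub>P\<^esub> y"
  shows "f x \<prec>\<^bsub>Q\<^esub> f y"
proof -
  have bij: "bij_betw f (carrier P) (carrier Q)"
    using iso by (simp add: poset_iso_def)
  then have surj: "carrier Q = f ` carrier P" by (simp add: bij_betw_def)
  have less: "f u \<sqsubset>\<^bsub>Q\<^esub> f v \<longleftrightarrow> u \<sqsubset>\<^bsub>P\<^esub> v" if "u \<in> carrier P" "v \<in> carrier P" for u v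
    using iso that bij by (auto simp: poset_iso_def lless_def P Q bij_betw_def inj_on_eq_iff)
  show ?thesis
    using xy by (auto simp: covered_by_def surj less)
qed

lemma viso_sym:
  assumes "P \<cong>\<^sub>V Q"
  shows "Q \<cong>\<^sub>V P"
proof -
  obtain f where f: "poset_iso f P Q" "\<forall>x \<in> carrier P. vcolor Q (f x) = vcolor P x"
    using assms by (auto simp: viso_def)
  let ?g = "inv_into (carrier P) f"
  have bij: "bij_betw f (carrier P) (carrier Q)"
    using f(1) by (simp add: poset_iso_def)
  have "vcolor P (?g y) = vcolor Q y" if "y \<in> carrier Q" for y
    using f(2) that bij_betw_inv_into_right[OF bij that] bij_betw_inv_into[OF bij]
    by (metis bij_betwE)
  with poset_iso_inv[OF f(1)] show ?thesis by (auto simp: viso_def)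
qed

lemma viso_trans:
  assumes "P \<cong>\<^sub>V Q" "Q \<cong>\<^sub>V R"
  shows "P \<cong>\<^sub>V R"
proof -
  obtain f g where f: "poset_iso f P Q" "\<forall>x \<in> carrier P. vcolor Q (f x) = vcolor P x"
    and g: "poset_iso g Q R" "\<forall>x \<in> carrier Q. vcolor R (g x) = vcolor Q x"
    using assms by (auto simp: viso_def)
  have "f x \<in> carrier Q" if "x \<in> carrier P" for x
    using f(1) that by (auto simp: poset_iso_def dest: bij_betwE)
  then have "\<forall>x \<in> carrier P. vcolor R ((g \<circ> f) x) = vcolor P x"
    using f(2) g(2) by simp
  with poset_iso_comp[OF f(1) g(1)] show ?thesis unfolding viso_def by blast
qed

text \<open>
  Only the colors of covering pairs are compared, so transporting colors along an isomorphism uses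
  that covers go to covers, and hence that \<^const>\<open>eq\<close> is the equality on both sides.
\<close>

lemma eiso_sym:
  assumes "P \<cong>\<^sub>E Q" "eq P = (=)" "eq Q = (=)"
  shows "Q \<cong>\<^sub>E P"
proof -
  obtain f where f: "poset_iso f P Q" "\<forall>x y. x \<prec>\<^bsub>P\<^esub> y \<longrightarrow> ecolor Q (f x) (f y) = ecolor P x y"
    using assms(1) by (auto simp: eiso_def)
  let ?g = "inv_into (carrier P) f"
  have bij: "bij_betw f (carrier P) (carrier Q)"
    using f(1) by (simp add: poset_iso_def)
  have "ecolor P (?g x) (?g y) = ecolor Q x y" if xy: "x \<prec>\<^bsub>Q\<^esub> y" for x y
  proof -
    have "?g x \<prec>\<^bsub>P\<^esub> ?g y"
      by (rule poset_iso_covered_by[OF poset_iso_inv[OF f(1)] assms(3,2) xy])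
    with f(2) have "ecolor P (?g x) (?g y) = ecolor Q (f (?g x)) (f (?g y))" by simp
    then show ?thesis
      using covered_by_carrier[OF xy] by (simp add: bij_betw_inv_into_right[OF bij])
  qed
  with poset_iso_inv[OF f(1)] show ?thesis by (auto simp: eiso_def)
qed

lemma eiso_trans:
  assumes "P \<cong>\<^sub>E Q" "Q \<cong>\<^sub>E R" "eq P = (=)" "eq Q = (=)"
  shows "P \<cong>\<^sub>E R"
proof -
  obtain f g where f: "poset_iso f P Q" "\<forall>x y. x \<prec>\<^bsub>P\<^esub> y \<longrightarrow> ecolor Q (f x) (f y) = ecolor P x y"
    and g: "poset_iso g Q R" "\<forall>x y. x \<prec>\<^bsub>Q\<^esub> y \<longrightarrow> ecolor R (g x) (g y) = ecolor Q x y"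
    using assms(1,2) by (auto simp: eiso_def)
  have "\<forall>x y. x \<prec>\<^bsub>P\<^esub> y \<longrightarrow> ecolor R ((g \<circ> f) x) ((g \<circ> f) y) = ecolor P x y"
    using f(2) g(2) poset_iso_covered_by[OF f(1) assms(3,4)] by simp
  with poset_iso_comp[OF f(1) g(1)] show ?thesis unfolding eiso_def by blast
qed

section \<open>Order duality\<close>

text \<open>
  Reversing also \<^const>\<open>eq\<close> makes the covering relation of the dual the converse of the original one
  for every record, so that \<open>m_color\<close> and \<open>M_color\<close> are expressed through their duals by equations
  between records rather than up to isomorphism.
\<close>

definition dual_v :: "('a, 'c) vposet \<Rightarrow> ('a, 'c) vposet" where
  "dual_v P = \<lparr>carrier = carrier P, eq = (\<lambda>x y. y .=\<^bsub>P\<^esub> x), le = (\<lambda>x y. y \<sqsubseteq>\<^bsub>P\<^esub> x),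
     vcolor = vcolor P\<rparr>"

definition dual_e :: "('a, 'c) eposet \<Rightarrow> ('a, 'c) eposet" where
  "dual_e L = \<lparr>carrier = carrier L, eq = (\<lambda>x y. y .=\<^bsub>L\<^esub> x), le = (\<lambda>x y. y \<sqsubseteq>\<^bsub>L\<^esub> x),
     ecolor = (\<lambda>x y. ecolor L y x)\<rparr>"

lemma dual_v_sel [simp]:
  "carrier (dual_v P) = carrier P" "eq (dual_v P) = (\<lambda>x y. y .=\<^bsub>P\<^esub> x)"
  "le (dual_v P) = (\<lambda>x y. y \<sqsubseteq>\<^bsub>P\<^esub> x)" "vcolor (dual_v P) = vcolor P"
  by (simp_all add: dual_v_def)

lemma dual_e_sel [simp]:
  "carrier (dual_e L) = carrier L" "eq (dual_e L) = (\<lambda>x y. y .=\<^bsub>L\<^esub> x)"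
  "le (dual_e L) = (\<lambda>x y. y \<sqsubseteq>\<^bsub>L\<^esub> x)" "ecolor (dual_e L) = (\<lambda>x y. ecolor L y x)"
  by (simp_all add: dual_e_def)

lemma dual_v_dual_v [simp]: "dual_v (dual_v P) = P"
  by (simp add: dual_v_def)

lemma dual_e_dual_e [simp]: "dual_e (dual_e L) = L"
  by (simp add: dual_e_def)

lemma lless_dual_e [simp]: "x \<sqsubset>\<^bsub>dual_e L\<^esub> y \<longleftrightarrow> y \<sqsubset>\<^bsub>L\<^esub> x"
  by (simp add: lless_def)

lemma covered_by_dual_e [simp]: "x \<prec>\<^bsub>dual_e L\<^esub> y \<longleftrightarrow> y \<prec>\<^bsub>L\<^esub> x"
  by (auto simp: covered_by_def)

lemma m_color_eq_dual_j_color: "m_color L = dual_v (j_color (dual_e L))"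
  by (simp add: m_color_def j_color_def dual_v_def meet_irreducibles_def join_irreducibles_def)

lemma M_color_eq_dual_J_color: "M_color P = dual_e (J_color (dual_v P))"
  by (simp add: M_color_def J_color_def dual_e_def order_filters_def order_ideals_def
      eq_commute fun_eq_iff)

lemma dual_v_viso:
  assumes "P \<cong>\<^sub>V Q"
  shows "dual_v P \<cong>\<^sub>V dual_v Q"
  using assms by (auto simp: viso_def poset_iso_def)

lemma dual_e_eiso:
  assumes "L \<cong>\<^sub>E K"
  shows "dual_e L \<cong>\<^sub>E dual_e K"
proof -
  obtain f where f: "poset_iso f L K" "\<forall>x y. x \<prec>\<^bsub>L\<^esub> y \<longrightarrow> ecolor K (f x) (f y) = ecolor L x y"
    using assms by (auto simp: eiso_def)
  have "poset_iso f (dual_e L) (dual_e K)"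
    using f(1) by (auto simp: poset_iso_def)
  with f(2) show ?thesis by (auto simp: eiso_def)
qed

lemma vertex_colored_poset_dual_v:
  assumes "vertex_colored_poset P"
  shows "vertex_colored_poset (dual_v P)"
proof -
  interpret vertex_colored_poset P by fact
  show ?thesis
    by unfold_locales
      (auto simp: eq_is_equal fun_eq_iff finite_carrier intro: le_antisym le_trans)
qed

context diamond_colored_distributive_lattice
begin

lemma meet_join_absorb: "\<lbrakk>x \<in> carrier L; y \<in> carrier L\<rbrakk> \<Longrightarrow> x \<sqinter> (x \<squnion> y) = x"
  using join_left le_iff_join by simp

lemma join_meet_absorb: "\<lbrakk>x \<in> carrier L; y \<in> carrier L\<rbrakk> \<Longrightarrow> x \<squnion> (x \<sqinter> y) = x"
  using meet_left[of x y] le_iff_meet[of "x \<sqinter> y" x] join_comm[of L x "x \<sqinter> y"] by simp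

text \<open>
  The dual of the distributive law, needed since \<^locale>\<open>diamond_colored_distributive_lattice\<close>
  assumes only one of the two laws.
\<close>

lemma join_distrib:
  assumes [simp]: "x \<in> carrier L" "y \<in> carrier L" "z \<in> carrier L"
  shows "x \<squnion> (y \<sqinter> z) = (x \<squnion> y) \<sqinter> (x \<squnion> z)"
proof -
  have "(x \<squnion> y) \<sqinter> (x \<squnion> z) = ((x \<squnion> y) \<sqinter> x) \<squnion> ((x \<squnion> y) \<sqinter> z)"
    by (simp add: distrib)
  also have "\<dots> = x \<squnion> (z \<sqinter> (x \<squnion> y))"
    by (simp add: meet_comm[of L _ x] meet_comm[of L _ z] meet_join_absorb)
  also have "\<dots> = x \<squnion> ((x \<sqinter> z) \<squnion> (y \<sqinter> z))"
    using distrib[of z x y] by (simp add: meet_comm[of L z x] meet_comm[of L z y])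
  also have "\<dots> = x \<squnion> (y \<sqinter> z)"
    using weak_join_assoc[of x "x \<sqinter> z" "y \<sqinter> z"]
    by (simp add: eq_is_equal join_meet_absorb)
  finally show ?thesis ..
qed

lemma dual_lattice_dual_e: "diamond_colored_distributive_lattice (dual_e L)"
proof -
  have Up: "Upper (dual_e L) A = Lower L A" and Lo: "Lower (dual_e L) A = Upper L A" for A
    by (simp_all add: Upper_def Lower_def)
  have least: "least (dual_e L) x A = greatest L x A"
    and greatest: "greatest (dual_e L) x A = least L x A" for x A
    by (simp_all add: least_def greatest_def)
  have join: "x \<squnion>\<^bsub>dual_e L\<^esub> y = x \<sqinter> y" and meet: "x \<sqinter>\<^bsub>dual_e L\<^esub> y = x \<squnion> y" for x y
    by (simp_all add: join_def meet_def sup_def inf_def Up Lo least greatest)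
  show ?thesis
  proof unfold_locales
    show "ecolor (dual_e L) v s = ecolor (dual_e L) t u \<and> ecolor (dual_e L) v t = ecolor (dual_e L) s u"
      if "v \<prec>\<^bsub>dual_e L\<^esub> s" "v \<prec>\<^bsub>dual_e L\<^esub> t" "s \<prec>\<^bsub>dual_e L\<^esub> u" "t \<prec>\<^bsub>dual_e L\<^esub> u" "s \<noteq> t" for v s t u
      using diamond[of u s t v] that by simp
  qed (auto simp: eq_is_equal fun_eq_iff finite_carrier nonempty join meet join_distrib
        Up Lo least greatest inf_of_two_exists sup_of_two_exists intro: le_antisym le_trans)
qed

end

section \<open>Ideals of join irreducibles of a distributive lattice\<close>

lemma join_irreducible_carrier: "j \<in> join_irreducibles L \<Longrightarrow> j \<in> carrier L"
  by (simp add: join_irreducibles_def)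

lemma order_ideals_j_color:
  "A \<in> order_ideals (j_color L) \<longleftrightarrow> A \<subseteq> join_irreducibles L
     \<and> (\<forall>x \<in> A. \<forall>y \<in> join_irreducibles L. y \<sqsubseteq>\<^bsub>L\<^esub> x \<longrightarrow> y \<in> A)"
  by (simp add: order_ideals_def j_color_def)

context diamond_colored_distributive_lattice
begin

definition birkhoff :: "'a \<Rightarrow> 'a set" where
  "birkhoff x = {j \<in> join_irreducibles L. j \<sqsubseteq> x}"

lemma lower_cover_eq:
  assumes "j \<in> join_irreducibles L" "a \<prec> j" "b \<prec> j"
  shows "a = b"
  using assms unfolding join_irreducibles_def by blast

text \<open>
  If \<open>j\<close> is below neither \<open>x\<close> nor \<open>y\<close>, then \<open>j \<sqinter> x\<close> and \<open>j \<sqinter> y\<close> are strictly below \<open>j\<close> and hence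
  below its only lower cover. So is their join, which by distributivity is \<open>j \<sqinter> (x \<squnion> y) = j\<close>.
\<close>

lemma join_irreducible_join_prime:
  assumes j: "j \<in> join_irreducibles L" and x: "x \<in> carrier L" and y: "y \<in> carrier L"
    and le: "j \<sqsubseteq> x \<squnion> y"
  shows "j \<sqsubseteq> x \<or> j \<sqsubseteq> y"
proof (rule ccontr)
  assume neg: "\<not> ?thesis"
  obtain j' where j': "j' \<prec> j" using j by (auto simp: join_irreducibles_def)
  have carr: "j \<in> carrier L" "j' \<in> carrier L" using covered_by_carrier[OF j'] by auto
  have below: "j \<sqinter> z \<sqsubseteq> j'" if z: "z \<in> carrier L" "\<not> j \<sqsubseteq> z" for z
  proof -
    have "j \<sqinter> z \<sqsubset> j"
      using z carr meet_left[of j z] meet_right[of j z] by (auto simp: lless_eq)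
    then obtain c where "j \<sqinter> z \<sqsubseteq> c" "c \<prec> j"
      using lower_cover_exists[of "j \<sqinter> z" j] z carr by auto
    with lower_cover_eq[OF j _ j'] show ?thesis by auto
  qed
  have "j = j \<sqinter> (x \<squnion> y)" using le le_iff_join[of j "x \<squnion> y"] x y carr by simp
  also have "\<dots> = (j \<sqinter> x) \<squnion> (j \<sqinter> y)" using x y carr by (simp add: distrib)
  also have "\<dots> \<sqsubseteq> j'" using below neg x y carr by (intro join_le) auto
  finally show False using covered_by_not_le[OF j'] by simp
qed

text \<open>
  Were \<open>a\<close> and \<open>b\<close> two lower covers of \<open>z\<close>, both would be below \<open>y\<close> and so would their join,
  which is \<open>z\<close>. There is at least one lower cover, since \<open>z \<sqinter> y\<close> is strictly below \<open>z\<close>.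
\<close>

lemma minimal_not_below_join_irreducible:
  assumes z: "z \<in> carrier L" and y: "y \<in> carrier L" and zy: "\<not> z \<sqsubseteq> y"
    and min: "\<And>w. \<lbrakk>w \<in> carrier L; w \<sqsubset> z\<rbrakk> \<Longrightarrow> w \<sqsubseteq> y"
  shows "z \<in> join_irreducibles L"
proof -
  have "z \<sqinter> y \<sqsubset> z"
    using z y zy meet_left[of z y] meet_right[of z y] by (auto simp: lless_eq)
  then obtain a where a: "a \<prec> z"
    using lower_cover_exists[of "z \<sqinter> y" z] z y by auto
  have "b = a" if b: "b \<prec> z" for b
  proof (rule ccontr)
    assume ne: "b \<noteq> a"
    have carr: "a \<in> carrier L" "b \<in> carrier L" using covered_by_carrier[OF a] covered_by_carrier[OF b] by auto
    have "a \<squnion> b \<sqsubseteq> z" using covered_by_le[OF a] covered_by_le[OF b] carr z by (simp add: join_le)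
    moreover have "a \<squnion> b \<noteq> a"
      using ne covered_by_between[OF b, of a] covered_by_le[OF a] covered_by_neq[OF a] carr
        join_right[of a b] by auto
    ultimately have "a \<squnion> b = z"
      using covered_by_between[OF a, of "a \<squnion> b"] carr join_left[of a b] by auto
    moreover have "a \<sqsubseteq> y" "b \<sqsubseteq> y"
      using min a b by (auto simp: covered_by_def)
    ultimately show False using join_le[of a y b] carr y zy by simp
  qed
  with a z show ?thesis by (auto simp: join_irreducibles_def)
qed

text \<open>
  A minimal element of the set of those below \<open>x\<close> but not below \<open>y\<close> is join irreducible. This is
  what makes \<open>birkhoff\<close> reflect the order.
\<close>

lemma join_irreducible_separates:
  assumes x: "x \<in> carrier L" and y: "y \<in> carrier L" and xy: "\<not> x \<sqsubseteq> y"
  shows "\<exists>j \<in> join_irreducibles L. j \<sqsubseteq> x \<and> \<not> j \<sqsubseteq> y"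
proof -
  let ?A = "{z \<in> carrier L. z \<sqsubseteq> x \<and> \<not> z \<sqsubseteq> y}"
  have "x \<in> ?A" using x xy by simp
  then obtain z where z: "z \<in> ?A" and min: "\<forall>w \<in> ?A. w \<sqsubseteq> z \<longrightarrow> w = z"
    using exists_minimal[of ?A] by blast
  have "z \<in> join_irreducibles L"
  proof (rule minimal_not_below_join_irreducible[of z y])
    fix w assume w: "w \<in> carrier L" "w \<sqsubset> z"
    then have "w \<sqsubseteq> x" using z x le_trans[of w z x] by (simp add: lless_eq)
    with w min show "w \<sqsubseteq> y" by (auto simp: lless_eq)
  qed (use z y in auto)
  with z show ?thesis by blast
qed

lemma birkhoff_subset_iff:
  assumes "x \<in> carrier L" "y \<in> carrier L"
  shows "birkhoff x \<subseteq> birkhoff y \<longleftrightarrow> x \<sqsubseteq> y"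
proof
  assume "birkhoff x \<subseteq> birkhoff y"
  then show "x \<sqsubseteq> y" using join_irreducible_separates[OF assms] unfolding birkhoff_def by blast
next
  assume "x \<sqsubseteq> y"
  then show "birkhoff x \<subseteq> birkhoff y"
    using assms le_trans[of _ x y] by (auto simp: birkhoff_def join_irreducible_carrier)
qed

lemma birkhoff_join:
  assumes "x \<in> carrier L" "y \<in> carrier L"
  shows "birkhoff (x \<squnion> y) = birkhoff x \<union> birkhoff y"
proof
  show "birkhoff (x \<squnion> y) \<subseteq> birkhoff x \<union> birkhoff y"
    using join_irreducible_join_prime[OF _ assms] unfolding birkhoff_def by blast
  show "birkhoff x \<union> birkhoff y \<subseteq> birkhoff (x \<squnion> y)"
    using assms by (simp add: birkhoff_subset_iff join_left join_right)
qed

lemma birkhoff_in_order_ideals: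
  assumes "x \<in> carrier L"
  shows "birkhoff x \<in> order_ideals (j_color L)"
proof -
  have "k \<sqsubseteq> x" if "j \<in> birkhoff x" "k \<in> join_irreducibles L" "k \<sqsubseteq> j" for j k
    using that assms le_trans[of k j x] by (auto simp: birkhoff_def join_irreducible_carrier)
  then show ?thesis by (auto simp: order_ideals_j_color birkhoff_def)
qed

lemma exists_bottom: "\<exists>b \<in> carrier L. \<forall>x \<in> carrier L. b \<sqsubseteq> x"
proof -
  obtain b where b: "b \<in> carrier L" "\<forall>x \<in> carrier L. x \<sqsubseteq> b \<longrightarrow> x = b"
    using exists_minimal[OF subset_refl nonempty] by blast
  have "b \<sqsubseteq> x" if "x \<in> carrier L" for x
    using b that meet_left[of b x] meet_right[of b x] meet_closed[of b x] by metis
  with b show ?thesis by blast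
qed

text \<open>
  An ideal \<open>A\<close> of join irreducibles is the image of the join of its elements. The join is formed
  one element at a time, starting from the bottom element, which has an empty image as it covers
  nothing; by join primality, each step adds exactly the image of the new element.
\<close>

lemma birkhoff_surj:
  assumes "A \<in> order_ideals (j_color L)"
  shows "\<exists>x \<in> carrier L. birkhoff x = A"
proof -
  have A: "A \<subseteq> join_irreducibles L"
    and down: "\<And>i j. \<lbrakk>i \<in> A; j \<in> join_irreducibles L; j \<sqsubseteq> i\<rbrakk> \<Longrightarrow> j \<in> A"
    using assms by (auto simp: order_ideals_j_color)
  have carr: "A \<subseteq> carrier L" using A by (auto intro: join_irreducible_carrier)
  have "\<exists>x \<in> carrier L. birkhoff x = (\<Union>i\<in>F. birkhoff i)"
    if "finite F" "F \<subseteq> carrier L" for F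
    using that
  proof (induction F rule: finite_induct)
    case empty
    obtain b where b: "b \<in> carrier L" "\<forall>x \<in> carrier L. b \<sqsubseteq> x" using exists_bottom by blast
    have "birkhoff b = {}"
    proof (rule ccontr)
      assume "birkhoff b \<noteq> {}"
      then obtain j where j: "j \<in> join_irreducibles L" "j \<sqsubseteq> b" by (auto simp: birkhoff_def)
      then obtain j' where j': "j' \<prec> j" by (auto simp: join_irreducibles_def)
      then have "j \<sqsubseteq> j'"
        using le_trans[OF j(2)] b covered_by_carrier[OF j'] by auto
      with covered_by_not_le[OF j'] show False by simp
    qed
    with b(1) show ?case by auto
  next
    case (insert i F)
    then obtain x where "x \<in> carrier L" "birkhoff x = (\<Union>i\<in>F. birkhoff i)" by auto
    with insert.prems show ?case
      by (intro bexI[of _ "i \<squnion> x"]) (auto simp: birkhoff_join)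
  qed
  then have "\<exists>x \<in> carrier L. birkhoff x = (\<Union>i\<in>A. birkhoff i)"
    using carr finite_subset[OF carr finite_carrier] by blast
  moreover have "(\<Union>i\<in>A. birkhoff i) = A"
  proof (intro equalityI subsetI)
    fix j assume "j \<in> (\<Union>i\<in>A. birkhoff i)"
    then show "j \<in> A" using down by (auto simp: birkhoff_def)
  next
    fix j assume "j \<in> A"
    then have "j \<in> birkhoff j" using A carr by (auto simp: birkhoff_def)
    with \<open>j \<in> A\<close> show "j \<in> (\<Union>i\<in>A. birkhoff i)" by blast
  qed
  ultimately show ?thesis by simp
qed

lemma poset_iso_birkhoff: "poset_iso birkhoff L (J_color (j_color L))"
proof -
  have "inj_on birkhoff (carrier L)"
  proof (rule inj_onI)
    fix x y assume "x \<in> carrier L" "y \<in> carrier L" "birkhoff x = birkhoff y"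
    then show "x = y"
      using birkhoff_subset_iff[of x y] birkhoff_subset_iff[of y x] le_antisym by simp
  qed
  moreover have "birkhoff ` carrier L = order_ideals (j_color L)"
    using birkhoff_in_order_ideals birkhoff_surj by blast
  ultimately show ?thesis
    by (simp add: poset_iso_def bij_betw_def J_color_def birkhoff_subset_iff)
qed

text \<open>
  This is the modular law for covers: if \<open>w\<close> were strictly between \<open>x \<sqinter> z\<close> and \<open>z\<close>, then
  \<open>x \<squnion> w = y\<close>, and distributing \<open>z \<sqinter> (x \<squnion> w)\<close> gives \<open>z = w\<close>. It supplies the diamonds along
  which colors are transported.
\<close>

lemma meet_covered_by:
  assumes x: "x \<prec> y" and z: "z \<prec> y" and ne: "x \<noteq> z"
  shows "x \<sqinter> z \<prec> z"
proof -
  have carr: "x \<in> carrier L" "y \<in> carrier L" "z \<in> carrier L"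
    using covered_by_carrier[OF x] covered_by_carrier[OF z] by auto
  have "\<not> z \<sqsubseteq> x"
    using covered_by_between[OF z, of x] covered_by_le[OF x] covered_by_neq[OF x] carr ne by blast
  then have less: "x \<sqinter> z \<sqsubset> z"
    using carr meet_left[of x z] meet_right[of x z] by (auto simp: lless_eq)
  have False if w: "w \<in> carrier L" "x \<sqinter> z \<sqsubset> w" "w \<sqsubset> z" for w
  proof -
    have wz: "w \<sqsubseteq> z" and mw: "x \<sqinter> z \<sqsubseteq> w" using w by (auto simp: lless_eq)
    have "\<not> w \<sqsubseteq> x"
    proof
      assume "w \<sqsubseteq> x"
      with wz have "w \<sqsubseteq> x \<sqinter> z" using w carr by (simp add: meet_le)
      with mw w show False using carr le_antisym[of w "x \<sqinter> z"] by (auto simp: lless_eq)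
    qed
    moreover have "x \<squnion> w \<sqsubseteq> y"
      using covered_by_le[OF x] covered_by_le[OF z] le_trans[OF wz] w carr by (simp add: join_le)
    ultimately have "x \<squnion> w = y"
      using covered_by_between[OF x, of "x \<squnion> w"] carr w join_left[of x w] join_right[of x w] by auto
    moreover have wm: "z \<sqinter> w = w"
      using wz w carr le_iff_join[of w z] by (simp add: meet_comm[of L z w])
    ultimately have "z = z \<sqinter> (x \<squnion> w)"
      using le_iff_join[of z y] covered_by_le[OF z] carr by simp
    also have "\<dots> = (x \<sqinter> z) \<squnion> w"
      using distrib[of z x w] carr w wm by (simp add: meet_comm[of L z x])
    also have "\<dots> = w" using mw carr w le_iff_meet[of "x \<sqinter> z" w] by simp
    finally show False using w by (simp add: lless_eq)
  qed
  with less carr show ?thesis by (auto simp: covered_by_def)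
qed

text \<open>
  Take a counterexample \<open>a \<prec> b\<close> with \<open>b\<close> minimal. Then \<open>b\<close> is not join irreducible, as otherwise
  \<open>b\<close> and \<open>a\<close> would serve as \<open>v\<close> and \<open>v'\<close>. So \<open>b\<close> has a second lower cover \<open>c\<close>, and the edge
  \<open>a \<sqinter> c \<rightarrow> c\<close> has the color of \<open>a \<rightarrow> b\<close> by the diamond condition. A join irreducible \<open>v\<close> for that
  lower edge is below \<open>c\<close> but not below \<open>a \<sqinter> c\<close>, hence not below \<open>a\<close>, and so also works for \<open>a \<rightarrow> b\<close>.
\<close>

lemma edge_color_from_join_irreducible:
  assumes "x \<prec> y"
  shows "\<exists>v v'. v \<in> join_irreducibles L \<and> v' \<prec> v \<and> v \<sqsubseteq> y \<and> \<not> v \<sqsubseteq> x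
           \<and> ecolor L v' v = ecolor L x y"
    (is "?G x y")
proof (rule ccontr)
  assume counterexample: "\<not> ?thesis"
  let ?B = "{y \<in> carrier L. \<exists>x. x \<prec> y \<and> \<not> ?G x y}"
  have "y \<in> ?B" using assms counterexample covered_by_carrier[OF assms] by blast
  then have "?B \<noteq> {}" by (metis empty_iff)
  moreover have "?B \<subseteq> carrier L" by (rule Collect_restrict)
  ultimately have "\<exists>m \<in> ?B. \<forall>u \<in> ?B. u \<sqsubseteq> m \<longrightarrow> u = m"
    by (intro exists_minimal)
  then obtain b where b: "b \<in> ?B" and min: "\<And>u. \<lbrakk>u \<in> ?B; u \<sqsubseteq> b\<rbrakk> \<Longrightarrow> u = b" by blast
  then obtain a where a: "a \<prec> b" and neg: "\<not> ?G a b" by blast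
  have "b \<notin> join_irreducibles L"
    using neg a covered_by_not_le[OF a] covered_by_carrier[OF a] le_refl[of b] by blast
  then obtain c where c: "c \<prec> b" "a \<noteq> c"
    using a covered_by_carrier[OF a] unfolding join_irreducibles_def by blast
  have carr: "a \<in> carrier L" "b \<in> carrier L" "c \<in> carrier L"
    using covered_by_carrier[OF a] covered_by_carrier[OF c(1)] by auto
  have mc: "a \<sqinter> c \<prec> c" and ma: "a \<sqinter> c \<prec> a"
    using meet_covered_by[OF a c] meet_covered_by[OF c(1) a] c(2) by (simp_all add: meet_comm)
  have color: "ecolor L (a \<sqinter> c) c = ecolor L a b"
    using diamond[OF ma mc a c(1)] c(2) by simp
  have "c \<notin> ?B" using min[of c] covered_by_le[OF c(1)] covered_by_neq[OF c(1)] by blast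
  then obtain v v' where v: "v \<in> join_irreducibles L" "v' \<prec> v" "v \<sqsubseteq> c" "\<not> v \<sqsubseteq> a \<sqinter> c"
    "ecolor L v' v = ecolor L (a \<sqinter> c) c"
    using mc carr by blast
  have "v \<in> carrier L" using v(1) by (rule join_irreducible_carrier)
  then have "v \<sqsubseteq> b" "\<not> v \<sqsubseteq> a"
    using v(3,4) carr le_trans[of v c b] covered_by_le[OF c(1)] meet_le[of v a c] by auto
  with v color neg show False by auto
qed

text \<open>
  Each of the two satisfies \<open>x \<squnion> j = y = x \<squnion> k\<close>, so by join primality each is below the other.
\<close>

lemma join_irreducible_between_unique:
  assumes xy: "x \<prec> y" and j: "j \<in> join_irreducibles L" "j \<sqsubseteq> y" "\<not> j \<sqsubseteq> x"
    and k: "k \<in> join_irreducibles L" "k \<sqsubseteq> y" "\<not> k \<sqsubseteq> x"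
  shows "j = k"
proof -
  have carr: "x \<in> carrier L" "y \<in> carrier L" using covered_by_carrier[OF xy] by auto
  have "i \<sqsubseteq> l" if i: "i \<in> join_irreducibles L" "i \<sqsubseteq> y" "\<not> i \<sqsubseteq> x"
    and l: "l \<in> join_irreducibles L" "l \<sqsubseteq> y" "\<not> l \<sqsubseteq> x" for i l
  proof -
    have lc: "l \<in> carrier L" using l(1) by (rule join_irreducible_carrier)
    have "x \<squnion> l \<sqsubseteq> y" using l lc carr covered_by_le[OF xy] by (simp add: join_le)
    then have "x \<squnion> l = y"
      using covered_by_between[OF xy, of "x \<squnion> l"] lc carr join_left[of x l] join_right[of x l] l(3)
      by auto
    with join_irreducible_join_prime[OF i(1) carr(1) lc] i show ?thesis by simp
  qed
  with j k show ?thesis using le_antisym join_irreducible_carrier by metis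
qed

theorem eiso_J_color_j_color: "L \<cong>\<^sub>E J_color (j_color L)"
proof -
  have "ecolor (J_color (j_color L)) (birkhoff x) (birkhoff y) = ecolor L x y" if xy: "x \<prec> y" for x y
  proof -
    obtain v v' where v: "v \<in> join_irreducibles L" "v' \<prec> v" "v \<sqsubseteq> y" "\<not> v \<sqsubseteq> x"
      "ecolor L v' v = ecolor L x y"
      using edge_color_from_join_irreducible[OF xy] by blast
    have "birkhoff y - birkhoff x = {v}"
      using v join_irreducible_between_unique[OF xy] unfolding birkhoff_def by blast
    moreover have "(THE u. u \<prec> v) = v'"
      using v(2) lower_cover_eq[OF v(1)] by blast
    ultimately show ?thesis using v(5) by (simp add: J_color_def j_color_def)
  qed
  with poset_iso_birkhoff show ?thesis by (auto simp: eiso_def)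
qed

end

section \<open>Join irreducible ideals of a poset\<close>

lemma carrier_J_color [simp]: "carrier (J_color P) = order_ideals P"
  by (simp add: J_color_def)

lemma covered_by_J_color:
  "A \<prec>\<^bsub>J_color P\<^esub> B \<longleftrightarrow> A \<in> order_ideals P \<and> B \<in> order_ideals P \<and> A \<subset> B
     \<and> \<not> (\<exists>C \<in> order_ideals P. A \<subset> C \<and> C \<subset> B)"
  by (auto simp: covered_by_def lless_def J_color_def)

context vertex_colored_poset
begin

definition principal_ideal :: "'a \<Rightarrow> 'a set" where
  "principal_ideal p = {q \<in> carrier P. q \<sqsubseteq> p}"

definition maximal_in :: "'a \<Rightarrow> 'a set \<Rightarrow> bool" where
  "maximal_in m A \<longleftrightarrow> m \<in> A \<and> (\<forall>x \<in> A. m \<sqsubseteq> x \<longrightarrow> x = m)"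

lemma principal_ideal_in_order_ideals:
  assumes "p \<in> carrier P"
  shows "principal_ideal p \<in> order_ideals P"
  using assms by (auto simp: order_ideals_def principal_ideal_def intro: le_trans)

lemma exists_maximal_above:
  assumes A: "A \<subseteq> carrier P" and x: "x \<in> A"
  shows "\<exists>m. maximal_in m A \<and> x \<sqsubseteq> m"
proof -
  let ?B = "{y \<in> A. x \<sqsubseteq> y}"
  have "x \<in> ?B" using A x by auto
  then obtain m where m: "m \<in> ?B" "\<forall>y \<in> ?B. m \<sqsubseteq> y \<longrightarrow> y = m"
    using exists_maximal[of ?B] A by blast
  have "maximal_in m A"
    unfolding maximal_in_def
  proof (intro conjI ballI impI)
    fix y assume "y \<in> A" "m \<sqsubseteq> y"
    moreover have "x \<sqsubseteq> y" using calculation m(1) A x le_trans[of x m y] by blast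
    ultimately show "y = m" using m(2) by blast
  qed (use m in blast)
  with m show ?thesis by blast
qed

text \<open>
  If \<open>B\<close> is a proper subideal of \<open>A\<close>, a maximal element \<open>m\<close> of \<open>A\<close> above an element of \<open>A - B\<close> is not in
  \<open>B\<close>, since \<open>B\<close> is down-closed. So \<open>B \<subseteq> A - {m}\<close>, and as \<open>A - {m}\<close> is an ideal, the two agree if \<open>A\<close>
  covers \<open>B\<close>.
\<close>

lemma covered_by_J_color_iff:
  assumes A: "A \<in> order_ideals P"
  shows "B \<prec>\<^bsub>J_color P\<^esub> A \<longleftrightarrow> (\<exists>m. maximal_in m A \<and> B = A - {m})"
proof
  assume B: "B \<prec>\<^bsub>J_color P\<^esub> A"
  then have BI: "B \<in> order_ideals P" and sub: "B \<subset> A" by (auto simp: covered_by_J_color)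
  have carr: "A \<subseteq> carrier P" using A by (simp add: order_ideals_def)
  obtain x where "x \<in> A - B" using sub by blast
  then obtain m where m: "maximal_in m A" "x \<sqsubseteq> m"
    using exists_maximal_above[OF carr] by blast
  then have mA: "m \<in> A" by (simp add: maximal_in_def)
  have "m \<notin> B" using BI \<open>x \<in> A - B\<close> m(2) carr by (auto simp: order_ideals_def)
  moreover have "A - {m} \<in> order_ideals P"
    using A m(1) by (auto simp: order_ideals_def maximal_in_def)
  ultimately have "B = A - {m}"
    using B sub mA by (auto simp: covered_by_J_color)
  with m show "\<exists>m. maximal_in m A \<and> B = A - {m}" by blast
next
  assume "\<exists>m. maximal_in m A \<and> B = A - {m}"
  then obtain m where m: "maximal_in m A" "B = A - {m}" by blast
  then have "m \<in> A" by (simp add: maximal_in_def)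
  moreover have "A - {m} \<in> order_ideals P"
    using A m(1) by (auto simp: order_ideals_def maximal_in_def)
  ultimately show "B \<prec>\<^bsub>J_color P\<^esub> A"
    using A m(2) by (auto simp: covered_by_J_color)
qed

lemma maximal_in_principal_ideal_iff:
  assumes "p \<in> carrier P"
  shows "maximal_in m (principal_ideal p) \<longleftrightarrow> m = p"
  using assms by (auto simp: maximal_in_def principal_ideal_def intro: le_antisym)

lemma covered_by_principal_ideal_iff:
  assumes "p \<in> carrier P"
  shows "B \<prec>\<^bsub>J_color P\<^esub> principal_ideal p \<longleftrightarrow> B = principal_ideal p - {p}"
  using covered_by_J_color_iff[OF principal_ideal_in_order_ideals[OF assms]]
    maximal_in_principal_ideal_iff[OF assms] by simp

text \<open>
  By the description of covers, an ideal has exactly one lower cover iff it has exactly one maximal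
  element \<open>p\<close>. Every element of a finite ideal is below a maximal one, so that ideal is generated
  by \<open>p\<close>.
\<close>

lemma join_irreducibles_J_color:
  "join_irreducibles (J_color P) = principal_ideal ` carrier P"
proof (intro equalityI subsetI)
  fix A assume "A \<in> join_irreducibles (J_color P)"
  then have A: "A \<in> order_ideals P" and ex1: "\<exists>!B. B \<prec>\<^bsub>J_color P\<^esub> A"
    by (auto simp: join_irreducibles_def)
  then obtain p where p: "maximal_in p A"
    by (auto simp: covered_by_J_color_iff[OF A])
  have carr: "A \<subseteq> carrier P" and pA: "p \<in> A"
    using A p by (auto simp: order_ideals_def maximal_in_def)
  have uniq: "m = p" if m: "maximal_in m A" for m
  proof -
    have "A - {m} = A - {p}" using ex1 m p unfolding covered_by_J_color_iff[OF A] by blast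
    moreover have "m \<in> A" using m by (simp add: maximal_in_def)
    ultimately show ?thesis using pA by blast
  qed
  have "A = principal_ideal p"
    using exists_maximal_above[OF carr] uniq carr pA A
    by (auto simp: principal_ideal_def order_ideals_def)
  then show "A \<in> principal_ideal ` carrier P" using carr pA by blast
next
  fix A assume "A \<in> principal_ideal ` carrier P"
  then show "A \<in> join_irreducibles (J_color P)"
    by (auto simp: join_irreducibles_def covered_by_principal_ideal_iff
        principal_ideal_in_order_ideals)
qed

lemma principal_ideal_subset_iff:
  assumes "p \<in> carrier P" "q \<in> carrier P"
  shows "principal_ideal p \<subseteq> principal_ideal q \<longleftrightarrow> p \<sqsubseteq> q"
  using assms le_trans by (auto simp: principal_ideal_def)

theorem viso_j_color_J_color: "P \<cong>\<^sub>V j_color (J_color P)"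
proof -
  have "inj_on principal_ideal (carrier P)"
  proof (rule inj_onI)
    fix p q assume "p \<in> carrier P" "q \<in> carrier P" "principal_ideal p = principal_ideal q"
    then show "p = q"
      using principal_ideal_subset_iff[of p q] principal_ideal_subset_iff[of q p] le_antisym by simp
  qed
  then have "poset_iso principal_ideal P (j_color (J_color P))"
    by (simp add: poset_iso_def bij_betw_def j_color_def join_irreducibles_J_color)
      (simp add: J_color_def principal_ideal_subset_iff)
  moreover have "vcolor (j_color (J_color P)) (principal_ideal p) = vcolor P p"
    if p: "p \<in> carrier P" for p
  proof -
    have "principal_ideal p - (principal_ideal p - {p}) = {p}"
      using p by (auto simp: principal_ideal_def)
    then show ?thesis
      by (simp add: j_color_def covered_by_principal_ideal_iff[OF p]) (simp add: J_color_def)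
  qed
  ultimately show ?thesis by (auto simp: viso_def)
qed

end

section \<open>The fundamental theorem\<close>

theorem theorem2p6:
  fixes L :: "('a, 'c) eposet" and P :: "('b, 'd) vposet"
  shows "(diamond_colored_distributive_lattice L \<longrightarrow>
            L \<cong>\<^sub>E J_color (j_color L) \<and> J_color (j_color L) \<cong>\<^sub>E M_color (m_color L))
       \<and> (vertex_colored_poset P \<longrightarrow>
            P \<cong>\<^sub>V j_color (J_color P) \<and> j_color (J_color P) \<cong>\<^sub>V m_color (M_color P))"
proof (intro conjI impI)
  assume L: "diamond_colored_distributive_lattice L"
  interpret diamond_colored_distributive_lattice L by (rule L)
  show J: "L \<cong>\<^sub>E J_color (j_color L)" by (rule eiso_J_color_j_color)
  have "dual_e (dual_e L) \<cong>\<^sub>E dual_e (J_color (j_color (dual_e L)))"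
    by (intro dual_e_eiso diamond_colored_distributive_lattice.eiso_J_color_j_color
        dual_lattice_dual_e)
  then have M: "L \<cong>\<^sub>E M_color (m_color L)"
    by (simp add: M_color_eq_dual_J_color m_color_eq_dual_j_color)
  have eq: "eq (J_color (j_color L)) = (=)" by (simp add: J_color_def)
  show "J_color (j_color L) \<cong>\<^sub>E M_color (m_color L)"
    by (rule eiso_trans[OF eiso_sym[OF J eq_is_equal eq] M eq eq_is_equal])
next
  assume P: "vertex_colored_poset P"
  show J: "P \<cong>\<^sub>V j_color (J_color P)"
    by (rule vertex_colored_poset.viso_j_color_J_color[OF P])
  have "dual_v (dual_v P) \<cong>\<^sub>V dual_v (j_color (J_color (dual_v P)))"
    by (intro dual_v_viso vertex_colored_poset.viso_j_color_J_color
        vertex_colored_poset_dual_v P)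
  then have "P \<cong>\<^sub>V m_color (M_color P)"
    by (simp add: M_color_eq_dual_J_color m_color_eq_dual_j_color)
  with viso_sym[OF J] show "j_color (J_color P) \<cong>\<^sub>V m_color (M_color P)"
    by (rule viso_trans)
qed

end
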